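(* For every graph $G$ without an induced copy of $C_4$, $$\max_{H\in\mathcal{H}(G)}\mathrm{mis}(H)=\mathrm{mis}(G).$$
   Context: Graphs are finite, simple and undirected. $C_4$ is the cycle of length 4. $\mathrm{mis}(G)$ is the number of (inclusion-)maximal independent sets of $G$. $\mathcal{H}(G)$ is the set of graphs obtained from $G$ by contracting some edges (loops and multiple edges are discarded; $G\in\mathcal{H}(G)$ by convention). *)

theory Defs
  imports "Graph_Theory.Graph_Theory"
begin

text \<open>
  Finite simple undirected graphs are the \<^locale>\<open>pair_graph\<close>s of the library, i.e. finite, loopfree,
  symmetric relations; an undirected edge is represented by its two orientations.
\<close>

definition independent_set :: "'a pair_pre_digraph \<Rightarrow> 'a set \<Rightarrow> bool" where
  "independent_set G S \<longleftrightarrow> S \<subseteq> pverts G \<and> (\<forall>u\<in>S. \<forall>v\<in>S. (u, v) \<notin> parcs G)"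

definition maximal_independent_set :: "'a pair_pre_digraph \<Rightarrow> 'a set \<Rightarrow> bool" where
  "maximal_independent_set G S \<longleftrightarrow>
     independent_set G S \<and> (\<forall>T. independent_set G T \<and> S \<subseteq> T \<longrightarrow> T = S)"

definition mis :: "'a pair_pre_digraph \<Rightarrow> nat" where
  "mis G = card {S. maximal_independent_set G S}"

text \<open>The cycle on \<open>n\<close> vertices; meaningful for \<open>n \<ge> 3\<close>.\<close>

definition cycle_graph :: "nat \<Rightarrow> nat pair_pre_digraph" where
  "cycle_graph n = \<lparr> pverts = {0..<n},
     parcs = (\<Union>i\<in>{0..<n}. {(i, (i + 1) mod n), ((i + 1) mod n, i)}) \<rparr>"

definition has_induced_copy :: "'b pair_pre_digraph \<Rightarrow> 'a pair_pre_digraph \<Rightarrow> bool" where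
  "has_induced_copy F G \<longleftrightarrow>
     (\<exists>H :: 'a pair_pre_digraph.
        induced_subgraph (with_proj H) (with_proj G) \<and> digraph_iso (with_proj F) (with_proj H))"

text \<open>
  Contracting the edge \<open>uv\<close> identifies \<open>v\<close> with \<open>u\<close>; the vertex arising from the contraction is
  named \<open>u\<close>, so that the type of vertices does not change. Loops are removed explicitly; parallel
  edges are merged because the edges form a set.
\<close>

definition contract_edge :: "'a pair_pre_digraph \<Rightarrow> 'a \<Rightarrow> 'a \<Rightarrow> 'a pair_pre_digraph" where
  "contract_edge G u v = (let f = id(v := u) in
     \<lparr> pverts = f ` pverts G, parcs = {(f x, f y) | x y. (x, y) \<in> parcs G \<and> f x \<noteq> f y} \<rparr>)"

inductive_set contractions :: "'a pair_pre_digraph \<Rightarrow> 'a pair_pre_digraph set"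
  for G :: "'a pair_pre_digraph" where
  refl: "G \<in> contractions G"
| step: "H \<in> contractions G \<Longrightarrow> (u, v) \<in> parcs H \<Longrightarrow> contract_edge H u v \<in> contractions G"

lemma parcs_contract_edge_iff:
  "(a, b) \<in> parcs (contract_edge G u v) \<longleftrightarrow>
     a \<noteq> b \<and> (\<exists>x y. (x, y) \<in> parcs G \<and> a = (id(v := u)) x \<and> b = (id(v := u)) y)"
  unfolding contract_edge_def Let_def pair_pre_digraph.simps mem_Collect_eq prod.inject by blast

lemma pverts_contract_edge_eq: "pverts (contract_edge G u v) = (id(v := u)) ` pverts G"
  by (simp add: contract_edge_def Let_def)

lemma pair_graph_contract_edge:
  assumes "pair_graph G"
  shows "pair_graph (contract_edge G u v)"
proof -
  interpret pair_graph G by fact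
  let ?f = "id(v := u)"
  have "parcs (contract_edge G u v) \<subseteq> (\<lambda>(x, y). (?f x, ?f y)) ` parcs G"
  proof (rule subrelI)
    fix a b assume "(a, b) \<in> parcs (contract_edge G u v)"
    then obtain x y where "(x, y) \<in> parcs G" "a = ?f x" "b = ?f y"
      unfolding parcs_contract_edge_iff by blast
    then show "(a, b) \<in> (\<lambda>(x, y). (?f x, ?f y)) ` parcs G"
      by (intro rev_image_eqI[of "(x, y)"]) simp_all
  qed
  then have fin: "finite (parcs (contract_edge G u v))"
    using pair_finite_arcs finite_surj by blast
  have S: "(y, x) \<in> parcs G" if "(x, y) \<in> parcs G" for x y
    using that pair_sym_arcs by (auto simp: symmetric_def dest: symD)
  have sym: "sym (parcs (contract_edge G u v))"
    by (rule symI) (use S in \<open>unfold parcs_contract_edge_iff, blast\<close>)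
  show ?thesis
  proof unfold_locales
    show "finite (pverts (contract_edge G u v))"
      using pair_finite_verts by (simp add: contract_edge_def Let_def)
    show "symmetric (with_proj (contract_edge G u v))"
      using sym by (simp add: symmetric_def)
  next
    fix e assume "e \<in> parcs (contract_edge G u v)"
    then obtain x y where xy: "(x, y) \<in> parcs G" "e = (?f x, ?f y)" "?f x \<noteq> ?f y"
      using parcs_contract_edge_iff[of "fst e" "snd e" G u v]
      by (cases e) (auto simp del: fun_upd_apply)
    show "fst e \<in> pverts (contract_edge G u v)" "snd e \<in> pverts (contract_edge G u v)"
        "fst e \<noteq> snd e"
      using wellformed'[OF xy(1)] xy(2,3)
      by (simp_all add: pverts_contract_edge_eq del: fun_upd_apply)
  qed (rule fin)
qed

lemma pair_graph_contractions:
  assumes "pair_graph G" "H \<in> contractions G"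
  shows "pair_graph H"
  using assms(2) by induction (simp_all add: assms(1) pair_graph_contract_edge)

lemma pverts_contract_edge:
  assumes "pair_graph G" "(u, v) \<in> parcs G"
  shows "pverts (contract_edge G u v) = pverts G - {v}"
proof -
  interpret pair_graph G by fact
  show ?thesis
    using wellformed'[OF assms(2)] pair_no_loops[OF assms(2)]
    by (auto simp: contract_edge_def Let_def split: if_splits)
qed

lemma pverts_contractions:
  assumes "pair_graph G" "H \<in> contractions G"
  shows "pverts H \<subseteq> pverts G"
  using assms(2)
proof induction
  case (step H u v)
  then show ?case
    using pverts_contract_edge[OF pair_graph_contractions[OF assms(1) step.hyps(1)]] by blast
qed simp

lemma finite_contractions:
  assumes "pair_graph G"
  shows "finite (contractions G)"
proof -
  interpret pair_graph G by fact
  let ?V = "pverts G"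
  have "contractions G \<subseteq>
      (\<lambda>(V, E). \<lparr> pverts = V, parcs = E \<rparr>) ` (Pow ?V \<times> Pow (?V \<times> ?V))"
  proof
    fix H assume H: "H \<in> contractions G"
    interpret H: pair_graph H using pair_graph_contractions[OF assms H] .
    have "pverts H \<subseteq> ?V" using pverts_contractions[OF assms H] .
    moreover have "parcs H \<subseteq> pverts H \<times> pverts H" using H.wellformed' by auto
    ultimately have "(pverts H, parcs H) \<in> Pow ?V \<times> Pow (?V \<times> ?V)" by blast
    then show "H \<in> (\<lambda>(V, E). \<lparr> pverts = V, parcs = E \<rparr>) ` (Pow ?V \<times> Pow (?V \<times> ?V))"
      by (rule rev_image_eqI) simp
  qed
  then show ?thesis using pair_finite_verts by (meson finite_Pow_iff finite_SigmaI finite_surj)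
qed

lemma finite_mis_contractions:
  "pair_graph G \<Longrightarrow> finite (mis ` contractions G)"
  by (simp add: finite_contractions)

end

theory Submission
  imports Defs
begin

text \<open>
  A contraction of \<open>G\<close> is a partition of the vertices into connected classes. Relax maximality by
  demanding domination only of the singleton classes outside a set: the unions of classes that are
  independent between classes and relaxed-maximal (\<open>relaxed_mis\<close>) are at least as many as the maximal
  independent sets of the contraction, and for the discrete partition they are the maximal
  independent sets of \<open>G\<close>. It remains to see that their number does not decrease when a vertex \<open>u\<close>
  is split off a class \<open>C\<close> such that \<open>C - {u}\<close> is still connected. If \<open>C - {u}\<close> has at least two
  elements, map \<open>X\<close> to a completion of \<open>X - {u}\<close>. If \<open>C = {u, p}\<close>, a set containing \<open>C\<close> gives up
  \<open>u\<close> or \<open>p\<close>, chosen such that the vertices which are left undominated expose any collision with the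
  image of a set avoiding \<open>C\<close>. The only remaining collision would produce two adjacent vertices, one
  adjacent to \<open>u\<close> only and the other to \<open>p\<close> only, that is, an induced 4-cycle.
\<close>

context pair_graph
begin

section \<open>Domination and maximal independent subsets\<close>

lemma parcs_commute: "(x, y) \<in> parcs G \<longleftrightarrow> (y, x) \<in> parcs G"
  using pair_sym_arcs by (auto simp: symmetric_def dest: symD)

lemma parcs_irrefl: "(x, x) \<notin> parcs G"
  using pair_no_loops by fastforce

lemma maximal_independent_set_iff:
  "maximal_independent_set G S \<longleftrightarrow>
     independent_set G S \<and> (\<forall>v\<in>pverts G - S. \<exists>x\<in>S. (x, v) \<in> parcs G)" (is "?L \<longleftrightarrow> ?R")
proof
  assume L: ?L
  then have S: "independent_set G S"
    by (simp add: maximal_independent_set_def)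
  have "\<exists>x\<in>S. (x, v) \<in> parcs G" if v: "v \<in> pverts G - S" for v
  proof (rule ccontr)
    assume "\<not> ?thesis"
    then have "independent_set G (insert v S)"
      using S v by (auto simp: independent_set_def parcs_commute[of v] parcs_irrefl)
    then show False
      using L v by (auto simp: maximal_independent_set_def)
  qed
  then show ?R
    using S by blast
next
  assume R: ?R
  have "T = S" if "independent_set G T" "S \<subseteq> T" for T
    using R that unfolding independent_set_def by blast
  then show ?L
    using R by (auto simp: maximal_independent_set_def)
qed

lemma ex_induced_maximal_independent:
  assumes "D \<subseteq> pverts G"
  shows "\<exists>M\<subseteq>D. independent_set G M \<and> (\<forall>v\<in>D - M. \<exists>x\<in>M. (x, v) \<in> parcs G)"
proof -
  let ?I = "{M. M \<subseteq> D \<and> independent_set G M}"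
  have "finite ?I"
    by (rule finite_subset[of _ "Pow (pverts G)"])
      (use assms pair_finite_verts in auto)
  moreover have "{} \<in> ?I"
    by (simp add: independent_set_def)
  ultimately obtain M where M: "M \<in> ?I" "\<And>T. T \<in> ?I \<Longrightarrow> M \<subseteq> T \<Longrightarrow> M = T"
    using finite_has_maximal2 by (metis (no_types, lifting))
  have "\<exists>x\<in>M. (x, v) \<in> parcs G" if v: "v \<in> D - M" for v
  proof (rule ccontr)
    assume "\<not> ?thesis"
    then have "insert v M \<in> ?I"
      using M(1) v assms by (auto simp: independent_set_def parcs_commute[of v] parcs_irrefl)
    then show False
      using M(2)[of "insert v M"] v by blast
  qed
  then show ?thesis
    using M(1) by blast
qed

text \<open>A chosen maximal independent subset of \<open>D\<close>. Any choice serves: the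
  injectivity arguments below use only that it lies inside \<open>D\<close>.\<close>

definition greedy :: "'a set \<Rightarrow> 'a set" where
  "greedy D = (SOME M. M \<subseteq> D \<and> independent_set G M \<and> (\<forall>v\<in>D - M. \<exists>x\<in>M. (x, v) \<in> parcs G))"

lemma greedy:
  assumes "D \<subseteq> pverts G"
  shows "greedy D \<subseteq> D" "independent_set G (greedy D)"
    "v \<in> D \<Longrightarrow> v \<notin> greedy D \<Longrightarrow> \<exists>x\<in>greedy D. (x, v) \<in> parcs G"
  using someI_ex[OF ex_induced_maximal_independent[OF assms], folded greedy_def]
  by blast+


subsection \<open>Relaxed maximal independent sets of a partition\<close>

text \<open>A partition of the vertices is given by the map \<open>r\<close> sending a vertex to the representative of
  its class.\<close>

definition fibre :: "('a \<Rightarrow> 'a) \<Rightarrow> 'a \<Rightarrow> 'a set" where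
  "fibre r p = {x \<in> pverts G. r x = p}"

text \<open>For the partition of a contraction, these are the preimages of the independent sets of
  the contracted graph.\<close>

definition separated :: "('a \<Rightarrow> 'a) \<Rightarrow> 'a set \<Rightarrow> bool" where
  "separated r X \<longleftrightarrow> X \<subseteq> pverts G \<and>
     (\<forall>x\<in>X. \<forall>y\<in>pverts G. r y = r x \<longrightarrow> y \<in> X) \<and>
     (\<forall>x\<in>X. \<forall>y\<in>X. (x, y) \<in> parcs G \<longrightarrow> r x = r y)"

definition undominated :: "('a \<Rightarrow> 'a) \<Rightarrow> 'a set \<Rightarrow> 'a set" where
  "undominated r X = {v \<in> pverts G - X.
     (\<forall>w\<in>pverts G. r w = r v \<longrightarrow> w = v) \<and> (\<forall>x\<in>X. (x, v) \<notin> parcs G)}"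

definition relaxed_mis :: "('a \<Rightarrow> 'a) \<Rightarrow> 'a set set" where
  "relaxed_mis r = {X. separated r X \<and> undominated r X = {}}"

definition completion :: "('a \<Rightarrow> 'a) \<Rightarrow> 'a set \<Rightarrow> 'a set" where
  "completion r A = A \<union> greedy (undominated r A)"

lemma finite_relaxed_mis: "finite (relaxed_mis r)"
  by (rule finite_subset[of _ "Pow (pverts G)"])
    (use pair_finite_verts in \<open>auto simp: relaxed_mis_def separated_def\<close>)

lemma undominated_subset: "undominated r X \<subseteq> pverts G"
  by (auto simp: undominated_def)

lemma undominatedD:
  assumes "v \<in> undominated r X"
  shows "v \<in> pverts G" "v \<notin> X" "x \<in> X \<Longrightarrow> (x, v) \<notin> parcs G"
  using assms by (auto simp: undominated_def)

text \<open>Undominated vertices are singleton classes without neighbours in \<open>A\<close>, so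
  adding an independent set of them respects both the classes and separation. A vertex left
  undominated would contradict the maximality of the greedy choice.\<close>

lemma completion_in_relaxed_mis:
  assumes "separated r A"
  shows "completion r A \<in> relaxed_mis r"
proof -
  let ?U = "undominated r A" and ?M = "greedy (undominated r A)"
  note M = greedy[OF undominated_subset[of r A]]
  have "separated r (A \<union> ?M)"
    unfolding separated_def
  proof (intro conjI ballI impI)
    show "A \<union> ?M \<subseteq> pverts G"
      using assms M(1) undominated_subset[of r A] by (auto simp: separated_def)
  next
    fix x y assume "x \<in> A \<union> ?M" "y \<in> pverts G" "r y = r x"
    then show "y \<in> A \<union> ?M"
      using assms M(1) by (auto simp: separated_def undominated_def)
  next
    fix x y assume xy: "x \<in> A \<union> ?M" "y \<in> A \<union> ?M" "(x, y) \<in> parcs G"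
    have "(a, m) \<notin> parcs G" if "a \<in> A" "m \<in> ?M" for a m
      using that M(1) by (auto simp: undominated_def)
    moreover have "(m, n) \<notin> parcs G" if "m \<in> ?M" "n \<in> ?M" for m n
      using that M(2) by (auto simp: independent_set_def)
    ultimately have "x \<in> A" "y \<in> A"
      using xy parcs_commute by blast+
    then show "r x = r y"
      using assms xy(3) by (auto simp: separated_def)
  qed
  moreover have "undominated r (A \<union> ?M) = {}"
  proof -
    have "v \<in> ?U \<and> v \<notin> ?M \<and> (\<forall>x\<in>?M. (x, v) \<notin> parcs G)" if "v \<in> undominated r (A \<union> ?M)" for v
      using that by (auto simp: undominated_def)
    then show ?thesis
      using M(3) by blast
  qed
  ultimately show ?thesis
    by (simp add: completion_def relaxed_mis_def)
qed

lemma relaxed_mis_discrete: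
  assumes "\<And>x. x \<in> pverts G \<Longrightarrow> r x = x"
  shows "relaxed_mis r = {S. maximal_independent_set G S}"
proof -
  have "separated r X \<longleftrightarrow> independent_set G X" for X
    unfolding separated_def independent_set_def
    using assms parcs_irrefl by (metis subset_eq)
  moreover have "undominated r X = {v \<in> pverts G - X. \<forall>x\<in>X. (x, v) \<notin> parcs G}" for X
    using assms by (auto simp: undominated_def)
  ultimately show ?thesis
    by (auto simp: relaxed_mis_def maximal_independent_set_iff)
qed


subsection \<open>Splitting a vertex off its class\<close>

text \<open>Since \<open>u\<close> is not a value of \<open>r\<close>, the name \<open>u\<close>
  belongs to the new class \<open>{u}\<close> alone; the old class of \<open>u\<close> merely loses
  \<open>u\<close>, and all other classes are unchanged.\<close>

lemma separated_split:
  assumes "separated r X" "u \<in> pverts G" "\<And>x. x \<in> pverts G \<Longrightarrow> r x \<noteq> u"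
  shows "separated (r(u := u)) (X - {u})"
  using assms unfolding separated_def by auto

lemma singleton_fibre_split:
  assumes "v \<in> undominated (r(u := u)) A" "v \<noteq> u" "r v \<noteq> r u"
    "\<And>x. x \<in> pverts G \<Longrightarrow> r x \<noteq> u"
  shows "\<forall>w\<in>pverts G. r w = r v \<longrightarrow> w = v"
  using assms by (auto simp: undominated_def split: if_splits)

text \<open>Completing \<open>X - {u}\<close> is injective. Besides \<open>u\<close>, the completion
  never touches the old class, so \<open>p\<close> shows whether \<open>X\<close> contained the
  class; in either case \<open>X\<close> can be recovered from its image.\<close>

lemma card_relaxed_mis_split_large:
  assumes u: "u \<in> pverts G" "\<And>x. x \<in> pverts G \<Longrightarrow> r x \<noteq> u"
    and p: "p \<in> pverts G" "q \<in> pverts G" "p \<noteq> q" "p \<noteq> u" "q \<noteq> u" "r p = r u" "r q = r u"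
    and k: "k \<in> pverts G" "r k = r u" "(k, u) \<in> parcs G"
  shows "card (relaxed_mis r) \<le> card (relaxed_mis (r(u := u)))"
proof (rule card_inj_on_le[OF _ _ finite_relaxed_mis])
  let ?r = "r(u := u)" and ?C = "fibre r (r u)" and ?N = "{w. (u, w) \<in> parcs G}"
  let ?f = "\<lambda>X. completion ?r (X - {u})"
  have ku: "k \<noteq> u" using k parcs_irrefl by blast
  show "?f ` relaxed_mis r \<subseteq> relaxed_mis ?r"
    using separated_split[OF _ u] completion_in_relaxed_mis by (auto simp: relaxed_mis_def)
  have whole: "?C \<subseteq> X" if "X \<in> relaxed_mis r" "X \<inter> ?C \<noteq> {}" for X
    using that unfolding relaxed_mis_def separated_def fibre_def by fastforce
  \<comment> \<open>One of \<open>p\<close> and \<open>q\<close> differs from \<open>v\<close>, so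
    the class of \<open>v\<close> is still no singleton after the split.\<close>
  have nU: "v \<notin> undominated ?r A" if "v \<in> ?C" "v \<noteq> u" for v A
    using that p u by (auto simp: undominated_def fibre_def)
  have not_fibre: "r v \<noteq> r u" if "v \<in> undominated ?r A" "v \<noteq> u" for v A
    using nU[of v A] that undominated_subset[of ?r A] by (auto simp: fibre_def)
  have "p \<notin> greedy (undominated ?r A)" for A
    using greedy(1)[OF undominated_subset] nU[of p] p by (fastforce simp: fibre_def)
  then have p_iff: "p \<in> ?f X \<longleftrightarrow> ?C \<subseteq> X" if "X \<in> relaxed_mis r" for X
    using p whole[OF that] by (auto simp: completion_def fibre_def)
  have outside: "X = ?f X - {u}" if X: "X \<in> relaxed_mis r" "\<not> ?C \<subseteq> X" for X
  proof -
    \<comment> \<open>Off the old class the singleton classes are the same as before and are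
      dominated by \<open>X\<close>, so the completion can add only \<open>u\<close>.\<close>
    have "undominated ?r X \<subseteq> {u}"
    proof
      fix v assume v: "v \<in> undominated ?r X"
      show "v \<in> {u}"
      proof (rule ccontr)
        assume "v \<notin> {u}"
        then have "\<forall>w\<in>pverts G. r w = r v \<longrightarrow> w = v"
          using singleton_fibre_split[OF v _ not_fibre[OF v] u(2)] by simp
        then have "v \<in> undominated r X"
          using v by (simp add: undominated_def)
        then show False
          using X by (auto simp: relaxed_mis_def)
      qed
    qed
    moreover have "u \<notin> X"
      using whole[OF X(1)] X(2) u by (auto simp: fibre_def)
    ultimately show ?thesis
      using greedy(1)[OF undominated_subset[of ?r X]] by (auto simp: completion_def)
  qed
  have inside: "X = (?f X - ?N) \<union> ?C" if X: "X \<in> relaxed_mis r" "?C \<subseteq> X" for X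
  proof -
    \<comment> \<open>A vertex that loses domination had \<open>u\<close> as its only neighbour in
      \<open>X\<close>, and \<open>u\<close> itself stays dominated by \<open>k\<close>. So the
      completion adds only neighbours of \<open>u\<close>.\<close>
    have "undominated ?r (X - {u}) \<subseteq> ?N"
    proof
      fix v assume v: "v \<in> undominated ?r (X - {u})"
      have vu: "v \<noteq> u"
        using v k ku X(2) by (auto simp: undominated_def fibre_def)
      then have "\<forall>w\<in>pverts G. r w = r v \<longrightarrow> w = v"
        using singleton_fibre_split[OF v _ not_fibre[OF v] u(2)] by simp
      moreover have "v \<notin> undominated r X"
        using X by (auto simp: relaxed_mis_def)
      ultimately show "v \<in> ?N"
        using v vu by (auto simp: undominated_def)
    qed
    moreover have uC: "u \<in> ?C"
      using u by (simp add: fibre_def)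
    \<comment> \<open>Separation confines the neighbours of \<open>u\<close> in \<open>X\<close> to
      the class of \<open>u\<close>; deleting all neighbours of \<open>u\<close> and restoring the
      class therefore undoes the map.\<close>
    moreover have "x \<in> ?C" if "x \<in> X" "x \<in> ?N" for x
    proof -
      have "r u = r x" "x \<in> pverts G"
        using X uC that unfolding relaxed_mis_def separated_def by blast+
      then show ?thesis
        by (simp add: fibre_def)
    qed
    ultimately show ?thesis
      using greedy(1)[OF undominated_subset[of ?r "X - {u}"]] X(2)
      unfolding completion_def by blast
  qed
  show "inj_on ?f (relaxed_mis r)"
  proof (rule inj_onI)
    fix X Y assume "X \<in> relaxed_mis r" "Y \<in> relaxed_mis r" "?f X = ?f Y"
    then show "X = Y"
      using p_iff inside outside by metis
  qed
qed

text \<open>Domination is now required of \<open>u\<close> and \<open>p\<close> too. Sets containing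
  the pair and sets avoiding it are each recovered from their images; the chord condition
  \<open>C4\<close> keeps the two kinds of images apart.\<close>

lemma card_relaxed_mis_split_pair:
  assumes C4: "\<And>a b c d. (a, b) \<in> parcs G \<Longrightarrow> (b, c) \<in> parcs G \<Longrightarrow> (c, d) \<in> parcs G \<Longrightarrow>
      (d, a) \<in> parcs G \<Longrightarrow> a \<noteq> c \<Longrightarrow> b \<noteq> d \<Longrightarrow> (a, c) \<in> parcs G \<or> (b, d) \<in> parcs G"
    and u: "\<And>x. x \<in> pverts G \<Longrightarrow> r x \<noteq> u"
    and up: "(u, p) \<in> parcs G" "fibre r (r u) = {u, p}"
  shows "card (relaxed_mis r) \<le> card (relaxed_mis (r(u := u)))"
proof (rule card_inj_on_le[OF _ _ finite_relaxed_mis])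
  let ?r = "r(u := u)" and ?N = "{w. (p, w) \<in> parcs G}"
  let ?U = "undominated ?r"
  have uV: "u \<in> pverts G" and pV: "p \<in> pverts G" and ne: "u \<noteq> p" and pu: "(p, u) \<in> parcs G"
    using up wellformed' parcs_irrefl parcs_commute by blast+
  have rp: "r p = r u" and fib: "\<And>x. x \<in> pverts G \<Longrightarrow> r x = r u \<longleftrightarrow> x = u \<or> x = p"
    using up by (auto simp: fibre_def)
  \<comment> \<open>If \<open>X\<close> contains the pair, the two sets consist of the vertices
    outside \<open>X\<close> whose only neighbour in \<open>X\<close> is \<open>u\<close>,
    respectively \<open>p\<close> (private neighbours). When \<open>keep_u\<close> fails,
    \<open>X - {u}\<close> needs no completion.\<close>
  define keep_u where "keep_u X \<longleftrightarrow> ?U (X - {u}) \<noteq> {} \<or> ?U (X - {p}) = {}" for X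
  \<comment> \<open>A set avoiding the pair takes \<open>p\<close> whenever possible, so that
    \<open>p\<close> missing from its image forces a neighbour of \<open>p\<close> in the
    set.\<close>
  define f where "f X =
    (if u \<in> X then if keep_u X then completion ?r (X - {p}) else X - {u}
     else if p \<in> ?U X then X \<union> {p} else completion ?r X)" for X
  have sepX: "separated r X" and undX: "undominated r X = {}" if "X \<in> relaxed_mis r" for X
    using that by (auto simp: relaxed_mis_def)
  have p_iff: "p \<in> X \<longleftrightarrow> u \<in> X" if "X \<in> relaxed_mis r" for X
    using sepX[OF that] uV pV rp unfolding separated_def by metis
  have sepu: "separated ?r (X - {u})" if "X \<in> relaxed_mis r" for X
    using separated_split[OF sepX[OF that] uV u] .
  have sepp: "separated ?r (X - {p})" if "X \<in> relaxed_mis r" "u \<in> X" for X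
    unfolding separated_def
  proof (intro conjI ballI impI)
    note X = sepX[OF that(1), unfolded separated_def]
    show "X - {p} \<subseteq> pverts G"
      using X by blast
    fix x assume x: "x \<in> X - {p}"
    then have xV: "x \<in> pverts G"
      using X by blast
    show "y \<in> X - {p}" if y: "y \<in> pverts G" "?r y = ?r x" for y
    proof (cases "x = u \<or> y = u")
      case True
      then have "y = x"
        using u[OF xV] u[OF y(1)] y(2) by (auto split: if_splits)
      then show ?thesis using x by simp
    next
      case False
      then have "r y = r x"
        using y(2) by simp
      moreover from this have "y \<noteq> p"
        using fib[OF xV] rp False x by auto
      ultimately show ?thesis
        using X x y(1) by blast
    qed
    show "?r x = ?r y" if y: "y \<in> X - {p}" "(x, y) \<in> parcs G" for y
    proof -
      have "r x = r y" "y \<in> pverts G"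
        using X x y by blast+
      moreover from this have "x = u \<longleftrightarrow> y = u"
        using fib[OF xV] fib[of y] x y(1) by auto
      ultimately show ?thesis
        by simp
    qed
  qed
  have D_sing: "\<forall>w\<in>pverts G. r w = r v \<longrightarrow> w = v" if "v \<in> ?U A" "v \<notin> {u, p}" for v A
  proof (rule singleton_fibre_split[OF that(1) _ _ u])
    show "v \<noteq> u" "r v \<noteq> r u"
      using that fib[of v] undominated_subset[of ?r A] by auto
  qed
  \<comment> \<open>Away from \<open>u\<close> and \<open>p\<close> both partitions have the same
    singleton classes, so relaxed maximality for \<open>r\<close> applies to
    \<open>v\<close>.\<close>
  have dom: "\<exists>x\<in>X. (x, v) \<in> parcs G"
    if "X \<in> relaxed_mis r" "v \<in> ?U A" "v \<notin> {u, p}" "v \<notin> X" for X A v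
    using undX[OF that(1)] D_sing[OF that(2,3)] that(2,4) by (auto simp: undominated_def)
  have Du: "v \<notin> X \<and> v \<notin> {u, p} \<and> (u, v) \<in> parcs G"
    if "X \<in> relaxed_mis r" "u \<in> X" "v \<in> ?U (X - {u})" for X v
  proof -
    have v: "v \<notin> {u, p}" "v \<notin> X"
      using that(2) p_iff[OF that(1)] undominatedD(2,3)[OF that(3)] pu ne by blast+
    then show ?thesis
      using dom[OF that(1,3)] undominatedD(3)[OF that(3)] by blast
  qed
  have Dp: "v \<notin> X \<and> v \<notin> {u, p} \<and> (p, v) \<in> parcs G"
    if "X \<in> relaxed_mis r" "u \<in> X" "v \<in> ?U (X - {p})" for X v
  proof -
    have v: "v \<notin> {u, p}" "v \<notin> X"
      using that(2) p_iff[OF that(1)] undominatedD(2,3)[OF that(3)] up ne by blast+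
    then show ?thesis
      using dom[OF that(1,3)] undominatedD(3)[OF that(3)] by blast
  qed
  have U_avoid: "?U X \<subseteq> {u, p}" if "X \<in> relaxed_mis r" for X
    using dom[OF that] undominatedD(2,3) by blast
  have p_sing: "\<forall>w\<in>pverts G. ?r w = ?r p \<longrightarrow> w = p"
    using fib rp ne u[OF uV] by (auto split: if_splits)
  note greedy_sub = greedy(1)[OF undominated_subset]

  show "f ` relaxed_mis r \<subseteq> relaxed_mis ?r"
  proof (rule image_subsetI)
    fix X assume X: "X \<in> relaxed_mis r"
    consider "u \<in> X" "keep_u X" | "u \<in> X" "\<not> keep_u X" | "u \<notin> X" "p \<notin> ?U X" | "u \<notin> X" "p \<in> ?U X"
      by blast
    then show "f X \<in> relaxed_mis ?r"
    proof cases
      case 1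
      then show ?thesis
        using completion_in_relaxed_mis[OF sepp[OF X]] by (simp add: f_def)
    next
      case 2
      then show ?thesis
        using sepu[OF X] by (simp add: f_def keep_u_def relaxed_mis_def)
    next
      case 3
      then show ?thesis
        using completion_in_relaxed_mis[OF sepu[OF X]] by (simp add: f_def)
    next
      case 4
      have "separated ?r X"
        using sepu[OF X] 4(1) by simp
      then have "separated ?r (X \<union> {p})"
        using 4(2) p_sing parcs_commute unfolding separated_def undominated_def by blast
      moreover have "?U (X \<union> {p}) \<subseteq> ?U X - {u, p}"
        using pu by (auto simp: undominated_def)
      ultimately show ?thesis
        using 4 U_avoid[OF X] by (auto simp: f_def relaxed_mis_def)
    qed
  qed

  have no_p: "(p, x) \<notin> parcs G" if "X \<in> relaxed_mis r" "u \<in> X" "x \<in> X" "x \<notin> {u, p}" for X x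
  proof
    assume e: "(p, x) \<in> parcs G"
    have "p \<in> X"
      using p_iff that(1,2) by blast
    with e have "r p = r x" "x \<in> pverts G"
      using sepX[OF that(1)] that(3) unfolding separated_def by blast+
    then show False
      using fib[of x] rp that(4) by auto
  qed
  \<comment> \<open>The completion adds only neighbours of \<open>p\<close>, and no vertex of
    \<open>X\<close> other than \<open>u\<close> is adjacent to \<open>p\<close>. This gives the
    formula recovering \<open>X\<close>.\<close>
  have f_keep_u: "u \<in> f X" "p \<notin> f X" "X = (f X - ?N) \<union> {u, p}"
      "f X - {u, p} = (X - {u, p}) \<union> greedy (?U (X - {p}))"
    if X: "X \<in> relaxed_mis r" "u \<in> X" "keep_u X" for X
  proof -
    have f: "f X = (X - {p}) \<union> greedy (?U (X - {p}))"
      using X by (simp add: f_def completion_def)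
    have G: "v \<notin> X \<and> v \<notin> {u, p} \<and> v \<in> ?N" if "v \<in> greedy (?U (X - {p}))" for v
      using that Dp[OF X(1,2)] greedy_sub by blast
    show "X = (f X - ?N) \<union> {u, p}"
      using f G no_p[OF X(1,2)] p_iff[OF X(1)] X(2) by blast
    show "u \<in> f X" "p \<notin> f X" "f X - {u, p} = (X - {u, p}) \<union> greedy (?U (X - {p}))"
      using f G X(2) ne by blast+
  qed
  have f_keep_p: "f X = X - {u}" "p \<in> f X" if "X \<in> relaxed_mis r" "u \<in> X" "\<not> keep_u X" for X
    using that p_iff ne by (auto simp: f_def)
  have f_avoid: "X = f X - {u, p}" "p \<in> f X \<longleftrightarrow> p \<in> ?U X" if X: "X \<in> relaxed_mis r" "u \<notin> X" for X
    using X p_iff[OF X(1)] U_avoid[OF X(1)] greedy_sub[of ?r X] by (auto simp: f_def completion_def)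
  have clash: "f X \<noteq> f Y"
    if X: "X \<in> relaxed_mis r" "u \<in> X" and Y: "Y \<in> relaxed_mis r" "u \<notin> Y" for X Y
  proof
    assume eq: "f X = f Y"
    show False
    proof (cases "keep_u X")
      case True
      note fX = f_keep_u[OF X True]
      have Y_eq: "Y = (X - {u, p}) \<union> greedy (?U (X - {p}))"
        using fX(4) f_avoid(1)[OF Y] eq by simp
      have no_X: "(x, p) \<notin> parcs G" if "x \<in> X - {u, p}" for x
        using that no_p[OF X] parcs_commute by blast
      \<comment> \<open>The image omits \<open>p\<close>, so \<open>p\<close> has a neighbour in
        \<open>Y\<close>; as \<open>X - {u, p}\<close> contains none, the completion must have added
        one.\<close>
      have "p \<notin> ?U Y" "p \<notin> Y"
        using fX(2) f_avoid(2)[OF Y] p_iff[OF Y(1)] Y(2) eq by auto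
      then have "\<exists>y\<in>Y. (y, p) \<in> parcs G"
        using p_sing pV by (auto simp: undominated_def)
      then have "?U (X - {p}) \<noteq> {}"
        using Y_eq no_X greedy_sub by blast
      \<comment> \<open>Since \<open>p\<close> has private neighbours, \<open>keep_u\<close> can
        hold only because \<open>u\<close> has one as well.\<close>
      then obtain d where d: "d \<in> ?U (X - {u})"
        using True by (auto simp: keep_u_def)
      note d' = Du[OF X d]
      have u_no: "(u, y) \<notin> parcs G" if "y \<in> greedy (?U (X - {p}))" for y
        using that greedy_sub X(2) ne undominatedD(3)[of y ?r "X - {p}" u] by blast
      \<comment> \<open>\<open>Y\<close> must dominate \<open>d\<close>, which has no neighbour in
        \<open>X - {u}\<close>; the dominating vertex \<open>y\<close> is thus an added private
        neighbour of \<open>p\<close>.\<close>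
      have "\<exists>y\<in>Y. (y, d) \<in> parcs G"
        using dom[OF Y(1) d] d' u_no Y_eq by blast
      then obtain y where y: "y \<in> greedy (?U (X - {p}))" "(y, d) \<in> parcs G"
        using Y_eq undominatedD(3)[OF d] by blast
      have "(p, y) \<in> parcs G" "y \<notin> {u, p}"
        using Dp[OF X] y(1) greedy_sub by blast+
      moreover have "(p, d) \<notin> parcs G"
        using undominatedD(3)[OF d] p_iff[OF X(1)] X(2) ne by blast
      \<comment> \<open>The 4-cycle \<open>u\<close>, \<open>p\<close>, \<open>y\<close>,
        \<open>d\<close> has no chord, because \<open>y\<close> is private to \<open>p\<close> and
        \<open>d\<close> is private to \<open>u\<close>.\<close>
      ultimately show False
        using C4[of u p y d] up y u_no[OF y(1)] d' parcs_commute by blast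
    next
      case False
      then obtain d where d: "d \<in> ?U (X - {p})"
        by (auto simp: keep_u_def)
      \<comment> \<open>Here \<open>Y\<close> lacks both \<open>u\<close> and \<open>p\<close>, and
        so cannot dominate the private neighbour \<open>d\<close> of \<open>p\<close>.\<close>
      have "Y = X - {u, p}"
        using f_keep_p(1)[OF X False] f_avoid(1)[OF Y] eq by auto
      then show False
        using dom[OF Y(1) d] Dp[OF X d] undominatedD(3)[OF d] by blast
    qed
  qed
  show "inj_on f (relaxed_mis r)"
  proof (rule inj_onI)
    fix X Y assume X: "X \<in> relaxed_mis r" and Y: "Y \<in> relaxed_mis r" and eq: "f X = f Y"
    show "X = Y"
    proof (cases "u \<in> X")
      case uX: True
      then have uY: "u \<in> Y"
        using clash[OF X uX Y] eq by blast
      show ?thesis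
      \<comment> \<open>Whether \<open>p\<close> lies in the image reveals which of the two vertices
        was kept.\<close>
      proof (cases "keep_u X")
        case True
        then have "keep_u Y"
          using f_keep_u(2)[OF X uX] f_keep_p(2)[OF Y uY] eq by metis
        then show ?thesis
          using f_keep_u(3)[OF X uX True] f_keep_u(3)[OF Y uY] eq by metis
      next
        case False
        then have "\<not> keep_u Y"
          using f_keep_u(2)[OF Y uY] f_keep_p(2)[OF X uX] eq by metis
        then show ?thesis
          using f_keep_p(1)[OF X uX False] f_keep_p(1)[OF Y uY] eq uX uY by blast
      qed
    next
      case uX: False
      then have "u \<notin> Y"
        using clash[OF Y _ X] eq by metis
      then show ?thesis
        using f_avoid(1)[OF X uX] f_avoid(1)[OF Y] eq by metis
    qed
  qed
qed


subsection \<open>Contractions as partitions into connected classes\<close>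

text \<open>Connectedness of the subgraph induced on \<open>C\<close>, phrased by cuts instead of
  paths. As arcs are symmetric, testing the side of each cut that contains the root \<open>p\<close>
  suffices.\<close>

definition rooted_connected :: "'a \<Rightarrow> 'a set \<Rightarrow> bool" where
  "rooted_connected p C \<longleftrightarrow>
     p \<in> C \<and> (\<forall>S. p \<in> S \<and> S \<subset> C \<longrightarrow> (\<exists>x\<in>S. \<exists>y\<in>C - S. (x, y) \<in> parcs G))"

lemma rooted_connectedD:
  "rooted_connected p C \<Longrightarrow> p \<in> S \<Longrightarrow> S \<subset> C \<Longrightarrow> \<exists>x\<in>S. \<exists>y\<in>C - S. (x, y) \<in> parcs G"
  by (simp add: rooted_connected_def)

lemma rooted_connected_insert:
  assumes "rooted_connected p C" "k \<in> C" "(k, u) \<in> parcs G"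
  shows "rooted_connected p (insert u C)"
  unfolding rooted_connected_def
proof (intro conjI allI impI)
  show "p \<in> insert u C"
    using assms(1) by (simp add: rooted_connected_def)
next
  fix S assume S: "p \<in> S \<and> S \<subset> insert u C"
  show "\<exists>x\<in>S. \<exists>y\<in>insert u C - S. (x, y) \<in> parcs G"
  proof (cases "C \<subseteq> S")
    case True
    then show ?thesis
      using S assms(2,3) by blast
  next
    case False
    then have "p \<in> S \<inter> C" "S \<inter> C \<subset> C"
      using S assms(1) by (auto simp: rooted_connected_def)
    from rooted_connectedD[OF assms(1) this] show ?thesis
      by blast
  qed
qed

lemma rooted_connected_union:
  assumes A: "rooted_connected p A" and B: "rooted_connected q B"
    and e: "x \<in> A" "y \<in> B" "(x, y) \<in> parcs G"
  shows "rooted_connected p (A \<union> B)"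
  unfolding rooted_connected_def
proof (intro conjI allI impI)
  show "p \<in> A \<union> B"
    using A by (simp add: rooted_connected_def)
next
  fix S assume S: "p \<in> S \<and> S \<subset> A \<union> B"
  consider "\<not> A \<subseteq> S" | "A \<subseteq> S" "y \<notin> S" | "A \<subseteq> S" "y \<in> S" "q \<in> S" | "A \<subseteq> S" "y \<in> S" "q \<notin> S"
    by blast
  then show "\<exists>x\<in>S. \<exists>y\<in>A \<union> B - S. (x, y) \<in> parcs G"
  proof cases
    case 1
    then have "p \<in> S \<inter> A" "S \<inter> A \<subset> A"
      using S A by (auto simp: rooted_connected_def)
    from rooted_connectedD[OF A this] show ?thesis
      by blast
  next
    case 2
    then show ?thesis
      using e by blast
  next
    case 3
    then have "q \<in> S \<inter> B" "S \<inter> B \<subset> B"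
      using S B by (auto simp: rooted_connected_def)
    from rooted_connectedD[OF B this] show ?thesis
      by blast
  next
    \<comment> \<open>The root \<open>q\<close> of \<open>B\<close> lies beyond the cut, so
      connectedness of \<open>B\<close> is applied to the complement \<open>B - S\<close>, which
      misses \<open>y\<close>, and the edge found is reversed.\<close>
    case 4
    then have "q \<in> B - S" "B - S \<subset> B"
      using B e by (auto simp: rooted_connected_def)
    from rooted_connectedD[OF B this] show ?thesis
      using parcs_commute by blast
  qed
qed

text \<open>Take a maximal connected proper subset \<open>K\<close> containing \<open>p\<close>. An
  edge leaving \<open>K\<close> inside \<open>C\<close> leads to some \<open>u\<close>, and
  \<open>insert u K\<close> is again connected, hence equals \<open>C\<close>.\<close>

lemma rooted_connected_leaf:
  assumes C: "rooted_connected p C" "finite C" "C \<noteq> {p}"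
  obtains u k where "u \<in> C" "u \<noteq> p" "k \<in> C - {u}" "(k, u) \<in> parcs G" "rooted_connected p (C - {u})"
proof -
  let ?K = "{K. K \<subset> C \<and> rooted_connected p K}"
  have "finite ?K"
    by (rule finite_subset[of _ "Pow C"]) (use C(2) in auto)
  moreover have "{p} \<in> ?K"
    using C by (auto simp: rooted_connected_def)
  ultimately obtain K where K: "K \<in> ?K" "\<And>L. L \<in> ?K \<Longrightarrow> K \<subseteq> L \<Longrightarrow> K = L"
    using finite_has_maximal2 by (metis (no_types, lifting))
  then have "p \<in> K" "K \<subset> C"
    by (simp_all add: rooted_connected_def)
  then obtain k u where ku: "k \<in> K" "u \<in> C - K" "(k, u) \<in> parcs G"
    using rooted_connectedD[OF C(1)] by meson
  have "rooted_connected p (insert u K)"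
    using rooted_connected_insert K(1) ku by blast
  then have "C = insert u K"
    using K(1) K(2)[of "insert u K"] ku(2) by blast
  then have "C - {u} = K"
    using ku(2) by blast
  then show ?thesis
    using that[of u k] ku \<open>p \<in> K\<close> K(1) by auto
qed

definition contraction_map :: "('a \<Rightarrow> 'a) \<Rightarrow> bool" where
  "contraction_map r \<longleftrightarrow>
     (\<forall>x\<in>pverts G. r x \<in> pverts G \<and> r (r x) = r x \<and> rooted_connected (r x) (fibre r (r x)))"

text \<open>Each split turns a leaf \<open>u\<close> of a class into a fixed point of the map, so
  the number of moved vertices drops until all classes are singletons.\<close>

lemma card_relaxed_mis_le_mis:
  assumes C4: "\<And>a b c d. (a, b) \<in> parcs G \<Longrightarrow> (b, c) \<in> parcs G \<Longrightarrow> (c, d) \<in> parcs G \<Longrightarrow>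
      (d, a) \<in> parcs G \<Longrightarrow> a \<noteq> c \<Longrightarrow> b \<noteq> d \<Longrightarrow> (a, c) \<in> parcs G \<or> (b, d) \<in> parcs G"
    and "contraction_map r"
  shows "card (relaxed_mis r) \<le> mis G"
  using assms(2)
proof (induction "card {x \<in> pverts G. r x \<noteq> x}" arbitrary: r rule: less_induct)
  case less
  note r = less.prems[unfolded contraction_map_def, rule_format]
  show ?case
  proof (cases "\<exists>x\<in>pverts G. r x \<noteq> x")
    case False
    then show ?thesis
      using relaxed_mis_discrete[of r] by (auto simp: mis_def)
  next
    case True
    then obtain x where x: "x \<in> pverts G" "r x \<noteq> x" by blast
    define p where "p = r x"
    let ?C = "fibre r p"
    have p: "p \<in> pverts G" "r p = p" "rooted_connected p ?C"
      using r[OF x(1)] by (auto simp: p_def)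
    have "finite ?C"
      using pair_finite_verts by (simp add: fibre_def)
    moreover have "x \<in> ?C" "x \<noteq> p"
      using x by (simp_all add: fibre_def p_def)
    then have "?C \<noteq> {p}"
      by blast
    ultimately obtain u k where u: "u \<in> ?C" "u \<noteq> p" "k \<in> ?C - {u}" "(k, u) \<in> parcs G"
        "rooted_connected p (?C - {u})"
      using rooted_connected_leaf[OF p(3)] by metis
    have uV: "u \<in> pverts G" and ru: "r u = p"
      using u(1) by (auto simp: fibre_def)
    \<comment> \<open>Values of \<open>r\<close> are fixed by \<open>r\<close>, but \<open>u\<close>
      is not; hence \<open>u\<close> is free to name a new class.\<close>
    have not_u: "r y \<noteq> u" if "y \<in> pverts G" for y
      using r[OF that] ru u(2) by auto
    let ?r = "r(u := u)"
    have fibre_u: "fibre ?r u = {u}"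
      using not_u uV by (auto simp: fibre_def)
    have fibre_other: "fibre ?r q = fibre r q - {u}" if "q \<noteq> u" for q
      using that by (auto simp: fibre_def)
    have "contraction_map ?r"
      unfolding contraction_map_def
    proof
      fix y assume y: "y \<in> pverts G"
      show "?r y \<in> pverts G \<and> ?r (?r y) = ?r y \<and> rooted_connected (?r y) (fibre ?r (?r y))"
      proof (cases "y = u")
        case True
        then show ?thesis
          using uV fibre_u by (auto simp: rooted_connected_def)
      next
        case False
        have "rooted_connected (r y) (fibre r (r y) - {u})"
        proof (cases "r y = p")
          case True
          then show ?thesis using u(5) by simp
        next
          case False
          then have "fibre r (r y) - {u} = fibre r (r y)"
            using ru by (auto simp: fibre_def)
          then show ?thesis using r[OF y] by simp
        qed
        then show ?thesis
          using False r[OF y] not_u[OF y] fibre_other[OF not_u[OF y]] by simp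
      qed
    qed
    moreover have "{x \<in> pverts G. ?r x \<noteq> x} = {x \<in> pverts G. r x \<noteq> x} - {u}"
      by auto
    then have "card {x \<in> pverts G. ?r x \<noteq> x} < card {x \<in> pverts G. r x \<noteq> x}"
      using card_Diff1_less[of "{x \<in> pverts G. r x \<noteq> x}" u] pair_finite_verts uV ru u(2) by simp
    ultimately have "card (relaxed_mis ?r) \<le> mis G"
      using less.hyps by blast
    moreover have "card (relaxed_mis r) \<le> card (relaxed_mis ?r)"
    proof (cases "?C = {u, p}")
      case True
      then have "(u, p) \<in> parcs G"
        using u(3,4) parcs_commute by auto
      then show ?thesis
        using card_relaxed_mis_split_pair[OF C4 not_u] True ru by simp
    next
      case False
      then obtain q where "q \<in> ?C" "q \<noteq> u" "q \<noteq> p"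
        using u(1) p(1,2) by (auto simp: fibre_def)
      then show ?thesis
        using card_relaxed_mis_split_large[OF uV not_u p(1), where q = q and k = k] u p(2) ru
        by (auto simp: fibre_def)
    qed
    ultimately show ?thesis
      by linarith
  qed
qed

text \<open>Contracting an edge of \<open>H\<close> composes the map with the identification of
  \<open>v\<close> with \<open>u\<close>. That edge comes from an edge of \<open>G\<close> between
  the two classes, so their union is connected.\<close>

lemma contraction_map_of_contraction:
  assumes "H \<in> contractions G"
  obtains r where "contraction_map r" "pverts H = r ` pverts G"
    "parcs H = {(r x, r y) | x y. (x, y) \<in> parcs G \<and> r x \<noteq> r y}"
proof -
  have "\<exists>r. contraction_map r \<and> pverts H = r ` pverts G \<and>
      parcs H = {(r x, r y) | x y. (x, y) \<in> parcs G \<and> r x \<noteq> r y}"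
    using assms
  proof induction
    case refl
    have "contraction_map id"
      by (auto simp: contraction_map_def rooted_connected_def fibre_def)
    moreover have "parcs G = {(id x, id y) | x y. (x, y) \<in> parcs G \<and> id x \<noteq> id y}"
      using parcs_irrefl by auto
    moreover have "pverts G = id ` pverts G"
      by simp
    ultimately show ?case
      by blast
  next
    case (step H u v)
    then obtain r where r: "contraction_map r" "pverts H = r ` pverts G"
        "parcs H = {(r x, r y) | x y. (x, y) \<in> parcs G \<and> r x \<noteq> r y}"
      by blast
    obtain x y where xy: "u = r x" "v = r y" "(x, y) \<in> parcs G" "u \<noteq> v"
      using step.hyps(2) r(3) by auto
    have V: "x \<in> pverts G" "y \<in> pverts G"
      using xy(3) wellformed' by blast+
    note rD = r(1)[unfolded contraction_map_def, rule_format]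
    have ru: "r u = u" "u \<in> pverts G"
      using rD[OF V(1)] xy by auto
    let ?f = "id(v := u)"
    let ?r = "?f \<circ> r"
    have fibre_u: "fibre ?r u = fibre r u \<union> fibre r v"
      by (auto simp: fibre_def)
    have fibre_other: "fibre ?r q = fibre r q" if "q \<noteq> u" "q \<noteq> v" for q
      using that by (auto simp: fibre_def)
    have conn: "rooted_connected u (fibre r u \<union> fibre r v)"
      using rooted_connected_union[of u "fibre r u" v "fibre r v" x y] rD V xy
      by (auto simp: fibre_def)
    have "contraction_map ?r"
      unfolding contraction_map_def
    proof
      fix z assume z: "z \<in> pverts G"
      show "?r z \<in> pverts G \<and> ?r (?r z) = ?r z \<and> rooted_connected (?r z) (fibre ?r (?r z))"
      proof (cases "r z = u \<or> r z = v")
        case True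
        then have "?r z = u" by auto
        then show ?thesis
          using ru conn fibre_u xy(4) by simp
      next
        case False
        then have "?r z = r z" by simp
        then show ?thesis
          using rD[OF z] False fibre_other[of "r z"] by simp
      qed
    qed
    moreover have "pverts (contract_edge H u v) = ?r ` pverts G"
      unfolding pverts_contract_edge_eq r(2) image_comp ..
    moreover have "parcs (contract_edge H u v) =
        {(?r x, ?r y) | x y. (x, y) \<in> parcs G \<and> ?r x \<noteq> ?r y}"
    proof (rule set_eqI)
      fix e :: "'a \<times> 'a"
      obtain a b where e: "e = (a, b)" by fastforce
      have "e \<in> parcs (contract_edge H u v) \<longleftrightarrow>
          a \<noteq> b \<and> (\<exists>s t. (s, t) \<in> parcs H \<and> a = ?f s \<and> b = ?f t)"
        unfolding e parcs_contract_edge_iff ..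
      also have "\<dots> \<longleftrightarrow> a \<noteq> b \<and> (\<exists>x y. (x, y) \<in> parcs G \<and> a = ?f (r x) \<and> b = ?f (r y))"
        unfolding r(3) mem_Collect_eq prod.inject by metis
      also have "\<dots> \<longleftrightarrow> e \<in> {(?r x, ?r y) | x y. (x, y) \<in> parcs G \<and> ?r x \<noteq> ?r y}"
        unfolding e comp_def mem_Collect_eq prod.inject by blast
      finally show "e \<in> parcs (contract_edge H u v) \<longleftrightarrow>
        e \<in> {(?r x, ?r y) | x y. (x, y) \<in> parcs G \<and> ?r x \<noteq> ?r y}" .
    qed
    ultimately show ?case
      by blast
  qed
  then show ?thesis
    using that by blast
qed

text \<open>Taking preimages under \<open>r\<close> is injective on subsets of its image and turns
  maximal independent sets of \<open>H\<close> into relaxed ones.\<close>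

lemma mis_contraction_le_card_relaxed_mis:
  assumes "pair_graph H" and V: "pverts H = r ` pverts G"
    and E: "parcs H = {(r x, r y) | x y. (x, y) \<in> parcs G \<and> r x \<noteq> r y}"
  shows "mis H \<le> card (relaxed_mis r)"
  unfolding mis_def
proof (rule card_inj_on_le[OF _ _ finite_relaxed_mis])
  interpret H: pair_graph H by fact
  let ?g = "\<lambda>S. {x \<in> pverts G. r x \<in> S}"
  show "inj_on ?g {S. maximal_independent_set H S}"
  proof (rule inj_onI)
    fix S T assume "S \<in> {S. maximal_independent_set H S}" "T \<in> {S. maximal_independent_set H S}"
      and eq: "?g S = ?g T"
    then have "S \<subseteq> r ` pverts G" "T \<subseteq> r ` pverts G"
      by (simp_all add: maximal_independent_set_def independent_set_def V)
    then have "S = r ` ?g S" "T = r ` ?g T"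
      by blast+
    then show "S = T"
      using eq by metis
  qed
  show "?g ` {S. maximal_independent_set H S} \<subseteq> relaxed_mis r"
  proof (rule image_subsetI)
    fix S assume "S \<in> {S. maximal_independent_set H S}"
    then have S: "independent_set H S" "\<forall>v\<in>pverts H - S. \<exists>x\<in>S. (x, v) \<in> parcs H"
      by (simp_all add: H.maximal_independent_set_iff)
    have "separated r (?g S)"
      using S(1) unfolding separated_def independent_set_def E by auto
    moreover have "v \<notin> undominated r (?g S)" for v
    proof
      assume v: "v \<in> undominated r (?g S)"
      then have "r v \<in> pverts H - S"
        by (auto simp: undominated_def V)
      \<comment> \<open>An arc of \<open>H\<close> into \<open>r v\<close> lifts to an arc of
        \<open>G\<close> into the class of \<open>v\<close>; this class is \<open>{v}\<close>, so
        \<open>v\<close> itself is dominated.\<close>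
      then obtain x y where xy: "(x, y) \<in> parcs G" "r x \<in> S" "r y = r v"
        using S(2) E by force
      moreover have "x \<in> pverts G" "y \<in> pverts G"
        using xy(1) wellformed' by blast+
      ultimately show False
        using v by (auto simp: undominated_def)
    qed
    ultimately show "?g S \<in> relaxed_mis r"
      by (auto simp: relaxed_mis_def)
  qed
qed

section \<open>Chordless 4-cycles as induced copies of the cycle graph\<close>

lemma has_induced_copy_cycle_4I:
  assumes e: "(a, b) \<in> parcs G" "(b, c) \<in> parcs G" "(c, d) \<in> parcs G" "(d, a) \<in> parcs G"
    and ne: "a \<noteq> c" "b \<noteq> d" and non: "(a, c) \<notin> parcs G" "(b, d) \<notin> parcs G"
  shows "has_induced_copy (cycle_graph 4) G"
proof -
  let ?E = "{(a, b), (b, a), (b, c), (c, b), (c, d), (d, c), (d, a), (a, d)}"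
  let ?H = "\<lparr> pverts = {a, b, c, d}, parcs = ?E \<rparr>"
  have ne': "a \<noteq> b" "b \<noteq> c" "c \<noteq> d" "d \<noteq> a"
    using e parcs_irrefl by blast+
  have four: "{0..<4} = {0, 1, 2, 3::nat}"
    by auto
  have cyc: "pverts (cycle_graph 4) = {0, 1, 2, 3}"
      "parcs (cycle_graph 4) =
         {(0, 1), (1, 0), (1, 2), (2, 1), (2, 3), (3, 2), (3, 0), (0, 3)}"
    by (auto simp: cycle_graph_def four)
  have "wf_digraph (with_proj ?H)"
    by unfold_locales auto
  \<comment> \<open>As both diagonals are absent, the eight orientations of the cycle edges are all
    the arcs among the four vertices.\<close>
  moreover have E: "?E = {e \<in> parcs G. fst e \<in> {a, b, c, d} \<and> snd e \<in> {a, b, c, d}}"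
  proof
    have "(b, a) \<in> parcs G" "(c, b) \<in> parcs G" "(d, c) \<in> parcs G" "(a, d) \<in> parcs G"
      using e parcs_commute by blast+
    then show "?E \<subseteq> {e \<in> parcs G. fst e \<in> {a, b, c, d} \<and> snd e \<in> {a, b, c, d}}"
      using e by simp
    have "(c, a) \<notin> parcs G" "(d, b) \<notin> parcs G"
      using non parcs_commute by blast+
    then have "(x, y) \<in> ?E"
      if "(x, y) \<in> parcs G" "x \<in> {a, b, c, d}" "y \<in> {a, b, c, d}" for x y
      using that non parcs_irrefl by (elim insertE emptyE) simp_all
    then show "{e \<in> parcs G. fst e \<in> {a, b, c, d} \<and> snd e \<in> {a, b, c, d}} \<subseteq> ?E"
      by (intro subrelI) simp
  qed
  moreover have "?E \<subseteq> parcs G"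
    unfolding E by blast
  moreover have "{a, b, c, d} \<subseteq> pverts G"
    using e wellformed' by blast
  ultimately have "induced_subgraph (with_proj ?H) (with_proj G)"
    using wf_digraph_axioms
    unfolding induced_subgraph_def subgraph_def compatible_def with_proj_simps pair_pre_digraph.simps
    by blast
  moreover have "digraph_iso (with_proj (cycle_graph 4)) (with_proj ?H)"
  proof -
    define h where "h = (\<lambda>i::nat. if i = 0 then a else if i = 1 then b else if i = 2 then c else d)"
    define iso where "iso = \<lparr> iso_verts = h, iso_arcs = (\<lambda>(i, j). (h i, h j)),
      iso_head = snd, iso_tail = fst \<rparr>"
    have "wf_digraph (with_proj (cycle_graph 4))"
      by unfold_locales (auto simp: cyc)
    moreover have inj: "inj_on h {0, 1, 2, 3}"
      using ne ne' by (auto simp: h_def inj_on_def)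
    moreover have "inj_on (\<lambda>(i, j). (h i, h j)) (parcs (cycle_graph 4))"
    proof (rule inj_onI, clarify)
      fix i j k l assume "(i, j) \<in> parcs (cycle_graph 4)" "(k, l) \<in> parcs (cycle_graph 4)"
        "h i = h k" "h j = h l"
      then show "i = k \<and> j = l"
        using inj_onD[OF inj, of i k] inj_onD[OF inj, of j l] unfolding cyc by blast
    qed
    ultimately have "pre_digraph.digraph_isomorphism (with_proj (cycle_graph 4)) iso"
      unfolding pre_digraph.digraph_isomorphism_def by (auto simp: iso_def cyc(1))
    moreover have "with_proj ?H = app_iso iso (with_proj (cycle_graph 4))"
      by (auto simp: app_iso_def iso_def with_proj_def cyc h_def)
    ultimately show ?thesis
      unfolding digraph_iso_def by blast
  qed
  ultimately show ?thesis
    unfolding has_induced_copy_def by blast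
qed

end

theorem corollary3:
  fixes G :: "'a pair_pre_digraph"
  assumes "pair_graph G"
    and "\<not> has_induced_copy (cycle_graph 4) G"
  shows "(MAX H\<in>contractions G. mis H) = mis G"
proof (rule Max_eqI[OF finite_mis_contractions[OF assms(1)]])
  interpret pair_graph G by fact
  show "mis G \<in> mis ` contractions G"
    using contractions.refl by blast
  fix n assume "n \<in> mis ` contractions G"
  then obtain H where H: "H \<in> contractions G" "n = mis H" by blast
  obtain r where r: "contraction_map r" "pverts H = r ` pverts G"
      "parcs H = {(r x, r y) | x y. (x, y) \<in> parcs G \<and> r x \<noteq> r y}"
    using contraction_map_of_contraction[OF H(1)] .
  have "n \<le> card (relaxed_mis r)"
    using mis_contraction_le_card_relaxed_mis[OF pair_graph_contractions[OF assms(1) H(1)] r(2,3)] H(2)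
    by simp
  also have "\<dots> \<le> mis G"
    using card_relaxed_mis_le_mis[OF _ r(1)] has_induced_copy_cycle_4I assms(2) by blast
  finally show "n \<le> mis G" .
qed

end
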